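(* Let $R_*=\frac{3-\sqrt5}{2}$. There exists a neighborhood $U\subset\mathbb C$ of the real interval $(-R_*,1)$ such that for any real $x>1$ the series $$\frac{1}{[x]_q}=\sum_{N\ge0}\frac{q^{C_N}}{a_N(q)a_{N+1}(q)}$$ is absolutely convergent on $U$, uniformly on compact sets. Thus it converges to a holomorphic function on $U$. Consequently the function $q\mapsto[x]_q$ on $(-R_*,1)$ is real analytic.
   Context: For an integer $n\ge 0$ put $[n]_q=\frac{1-q^n}{1-q}$. Every real $x\ge1$ has a unique expansion $x=[[c_1,c_2,\ldots]]:=c_1-\frac{1}{c_2-\frac{1}{c_3-\cdots}}$ with integers $c_j\ge2$ (rational $x$ correspond to sequences eventually equal to $2$). The $q$-real number $[x]_q\in\mathbb Z[[q]]$ is the $q$-adic limit as $N\to\infty$ of $[c_1]_q-\frac{q^{c_1-1}}{[c_2]_q-\cdots\frac{q^{c_{N-1}-1}}{[c_N]_q}}$. Define polynomials $a_0(q)=1$, $a_1(q)=[c_1]_q$, $a_N(q)=[c_N]_q\,a_{N-1}(q)-q^{c_{N-1}-1}a_{N-2}(q)$ for $N\ge2$, and $C_N:=\sum_{j=1}^N(c_j-1)$ (so $C_0=0$). The displayed equality with $1/[x]_q$ holds $q$-adically. For real $q\in(-R_*,1)$ the series converges to a positive number, and the value of the function $q\mapsto [x]_q$ at such $q$ is defined as the reciprocal of the sum. The neighborhood $U$ does not depend on $x$. *)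

theory Defs
  imports "HOL-Complex_Analysis.Complex_Analysis"
begin

subsection \<open>Negative continued fractions\<close>

text \<open>
  Sequences of coefficients are indexed from 0: \<open>c j\<close> stands for the coefficient
  usually written $c_{j+1}$.  Accordingly \<open>nc_frac N c\<close> is the finite continued fraction
  $c_1 - 1/(c_2 - \cdots - 1/c_{N+1})$ with \<open>N + 1\<close> coefficients.
\<close>

primrec nc_frac :: "nat \<Rightarrow> (nat \<Rightarrow> nat) \<Rightarrow> real" where
  "nc_frac 0 c = real (c 0)"
| "nc_frac (Suc N) c = real (c 0) - 1 / nc_frac N (\<lambda>j. c (Suc j))"

definition nc_expansion :: "(nat \<Rightarrow> nat) \<Rightarrow> real \<Rightarrow> bool" where
  "nc_expansion c x \<longleftrightarrow> (\<forall>j. 2 \<le> c j) \<and> (\<lambda>N. nc_frac N c) \<longlonglongrightarrow> x"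

definition nc_coeffs :: "real \<Rightarrow> nat \<Rightarrow> nat" where
  "nc_coeffs x = (THE c. nc_expansion c x)"

lemma nc_frac_ge1:
  assumes "\<And>j. 2 \<le> c j"
  shows "1 \<le> nc_frac N c"
  using assms
proof (induction N arbitrary: c)
  case 0
  then have "2 \<le> c 0" by blast
  then show ?case by simp
next
  case (Suc N)
  have "1 \<le> nc_frac N (\<lambda>j. c (Suc j))" by (rule Suc.IH) (rule Suc.prems)
  then have "1 / nc_frac N (\<lambda>j. c (Suc j)) \<le> 1" by simp
  moreover have "2 \<le> real (c 0)" using Suc.prems[of 0] by simp
  ultimately show ?case by simp
qed

lemma nc_expansion_tail:
  assumes "nc_expansion c x"
  obtains y where "nc_expansion (\<lambda>j. c (Suc j)) y" "1 \<le> y" "x = real (c 0) - 1 / y"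
proof -
  have c: "\<And>j. 2 \<le> c j" and lim: "(\<lambda>N. nc_frac N c) \<longlonglongrightarrow> x"
    using assms by (auto simp: nc_expansion_def)
  let ?f = "\<lambda>N. nc_frac N (\<lambda>j. c (Suc j))"
  have ge: "1 \<le> ?f N" for N by (rule nc_frac_ge1) (rule c)
  have "(\<lambda>N. nc_frac (Suc N) c) \<longlonglongrightarrow> x" using lim by (rule LIMSEQ_Suc)
  then have "(\<lambda>N. real (c 0) - nc_frac (Suc N) c) \<longlonglongrightarrow> real (c 0) - x"
    by (intro tendsto_intros)
  then have inv: "(\<lambda>N. 1 / ?f N) \<longlonglongrightarrow> real (c 0) - x" by simp
  have bound: "?f N \<le> real (c (Suc 0))" for N
  proof (cases N)
    case (Suc M)
    have "0 \<le> 1 / nc_frac M (\<lambda>j. c (Suc (Suc j)))"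
      using nc_frac_ge1[of "\<lambda>j. c (Suc (Suc j))" M] c by simp
    then show ?thesis using Suc by simp
  qed simp
  have "1 / real (c (Suc 0)) \<le> 1 / ?f N" for N
    using bound[of N] ge[of N] by (simp add: frac_le)
  then have "1 / real (c (Suc 0)) \<le> real (c 0) - x"
    using inv by (intro LIMSEQ_le_const) auto
  moreover have "0 < 1 / real (c (Suc 0))" using c[of "Suc 0"] by simp
  ultimately have pos: "0 < real (c 0) - x" by linarith
  have "(\<lambda>N. 1 / (1 / ?f N)) \<longlonglongrightarrow> 1 / (real (c 0) - x)"
    using inv pos by (intro tendsto_intros) auto
  then have l: "?f \<longlonglongrightarrow> 1 / (real (c 0) - x)" by simp
  then have "1 \<le> 1 / (real (c 0) - x)" using ge by (intro LIMSEQ_le_const) auto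
  with l pos c show thesis
    by (intro that[of "1 / (real (c 0) - x)"]) (auto simp: nc_expansion_def)
qed

lemma nc_expansion_unique:
  assumes "nc_expansion c x" "nc_expansion d x"
  shows "c = d"
proof -
  have head: "int (c 0) = \<lfloor>x\<rfloor> + 1 \<and> nc_expansion (\<lambda>j. c (Suc j)) (1 / (real (c 0) - x))"
    if exp: "nc_expansion c x" for c :: "nat \<Rightarrow> nat" and x
  proof -
    obtain y where y: "nc_expansion (\<lambda>j. c (Suc j)) y" "1 \<le> y" "x = real (c 0) - 1 / y"
      by (rule nc_expansion_tail[OF exp])
    have "0 < 1 / y" "1 / y \<le> 1" using y(2) by auto
    then have "\<lfloor>x\<rfloor> = int (c 0) - 1" using y(3) by (intro floor_unique) auto
    then show ?thesis using y by simp
  qed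
  have "c n = d n" if "nc_expansion c x" "nc_expansion d x" for n
    using that
  proof (induction n arbitrary: c d x)
    case 0
    then show ?case using head by (metis of_nat_eq_iff)
  next
    case (Suc n)
    have "c 0 = d 0" using head Suc.prems by (metis of_nat_eq_iff)
    then show ?case using Suc.IH head Suc.prems by (metis (no_types, lifting))
  qed
  then show ?thesis using assms by blast
qed

lemma nc_expansion_exists:
  assumes "1 \<le> x"
  shows "\<exists>c. nc_expansion c x"
proof -
  define t :: "nat \<Rightarrow> real" where
    "t = rec_nat x (\<lambda>_ y. 1 / (of_int (\<lfloor>y\<rfloor> + 1) - y))"
  have t0: "t 0 = x" and tS: "t (Suc n) = 1 / (of_int (\<lfloor>t n\<rfloor> + 1) - t n)" for n
    by (simp_all add: t_def)
  define c where "c n = nat (\<lfloor>t n\<rfloor> + 1)" for n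
  have t1: "1 \<le> t n" for n
  proof (cases n)
    case (Suc m)
    have "0 < of_int (\<lfloor>t m\<rfloor> + 1) - t m" "of_int (\<lfloor>t m\<rfloor> + 1) - t m \<le> 1" by linarith+
    then show ?thesis using Suc tS by simp
  qed (use assms t0 in simp)
  have c2: "2 \<le> c n" for n
  proof -
    have "1 \<le> \<lfloor>t n\<rfloor>" using t1[of n] by linarith
    then have "2 \<le> \<lfloor>t n\<rfloor> + 1" by linarith
    then show ?thesis unfolding c_def by (subst le_nat_iff) auto
  qed
  have rc: "real (c n) = of_int (\<lfloor>t n\<rfloor> + 1)" for n
    using t1[of n] unfolding c_def by (subst of_nat_nat) auto
  have rel: "t n = real (c n) - 1 / t (Suc n)" for n
    unfolding tS rc by simp
  have err: "0 \<le> nc_frac N (\<lambda>j. c (n + j)) - t n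
      \<and> nc_frac N (\<lambda>j. c (n + j)) - t n \<le> 1 / real (Suc N)" for N n
  proof (induction N arbitrary: n)
    case 0
    have "real (c n) - t n = 1 / t (Suc n)" using rel[of n] by simp
    then show ?case using t1[of "Suc n"] by simp
  next
    case (Suc N)
    define y where "y = t (Suc n)"
    define e where "e = nc_frac N (\<lambda>j. c (Suc n + j)) - y"
    have y: "1 \<le> y" using t1 by (simp add: y_def)
    have e: "0 \<le> e" "e \<le> 1 / real (Suc N)" using Suc.IH[of "Suc n"] by (auto simp: e_def y_def)
    have "nc_frac (Suc N) (\<lambda>j. c (n + j)) = real (c n) - 1 / (y + e)"
      by (simp add: e_def)
    then have eq: "nc_frac (Suc N) (\<lambda>j. c (n + j)) - t n = 1 / y - 1 / (y + e)"
      using rel[of n] by (simp add: y_def)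
    have "1 / y - 1 / (y + e) = e / (y * (y + e))" using y e by (simp add: field_simps)
    also have "\<dots> \<le> e / (1 * (1 + e))"
      using y e by (intro divide_left_mono mult_mono) auto
    also have "\<dots> = 1 - 1 / (1 + e)" using e by (simp add: field_simps)
    also have "\<dots> \<le> 1 - 1 / (1 + 1 / real (Suc N))"
      using e by (intro diff_left_mono divide_left_mono) (auto intro!: mult_pos_pos add_pos_nonneg)
    also have "\<dots> = 1 / real (Suc (Suc N))" by (simp add: field_simps)
    finally have "1 / y - 1 / (y + e) \<le> 1 / real (Suc (Suc N))" .
    moreover have "0 \<le> 1 / y - 1 / (y + e)" using y e by (simp add: frac_le)
    ultimately show ?case unfolding eq by blast
  qed
  have "(\<lambda>N. nc_frac N c - x) \<longlonglongrightarrow> 0"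
  proof (rule tendsto_sandwich[of "\<lambda>_. 0" _ _ "\<lambda>N. 1 / real (Suc N)"])
    show "(\<lambda>N. 1 / real (Suc N)) \<longlonglongrightarrow> 0"
      using LIMSEQ_inverse_real_of_nat by (simp add: inverse_eq_divide)
  qed (use err[of _ 0] t0 in auto)
  then have "(\<lambda>N. nc_frac N c) \<longlonglongrightarrow> x" by (simp add: LIM_zero_iff)
  then show ?thesis using c2 unfolding nc_expansion_def by blast
qed

lemma nc_expansion_nc_coeffs:
  assumes "1 \<le> x"
  shows "nc_expansion (nc_coeffs x) x"
  unfolding nc_coeffs_def
  using nc_expansion_exists[OF assms] nc_expansion_unique by (metis theI')


subsection \<open>The q-integers, the polynomials and the exponents\<close>

text \<open>
  The polynomials are given through their values at a point \<open>q\<close> of an arbitrary commutative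
  ring; they are evaluated below at real and complex numbers and at the indeterminate of the
  ring of formal power series over the integers.
\<close>

definition q_nat :: "'a::comm_ring_1 \<Rightarrow> nat \<Rightarrow> 'a" where
  "q_nat q n = (\<Sum>i<n. q ^ i)"

lemma q_nat_eq: "(1 - q) * q_nat q n = 1 - q ^ n"
  by (simp add: q_nat_def one_diff_power_eq)

fun q_denom :: "(nat \<Rightarrow> nat) \<Rightarrow> 'a::comm_ring_1 \<Rightarrow> nat \<Rightarrow> 'a" where
  "q_denom c q 0 = 1"
| "q_denom c q (Suc 0) = q_nat q (c 0)"
| "q_denom c q (Suc (Suc N)) =
     q_nat q (c (Suc N)) * q_denom c q (Suc N) - q ^ (c N - 1) * q_denom c q N"

definition C_exp :: "(nat \<Rightarrow> nat) \<Rightarrow> nat \<Rightarrow> nat" where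
  "C_exp c N = (\<Sum>j<N. c j - 1)"

definition q_term :: "(nat \<Rightarrow> nat) \<Rightarrow> 'a::field \<Rightarrow> nat \<Rightarrow> 'a" where
  "q_term c q N = q ^ C_exp c N / (q_denom c q N * q_denom c q (Suc N))"


subsection \<open>q-real numbers as formal power series\<close>

text \<open>
  Over the integers only the series with constant coefficient 1 or -1 are units.
  \<open>fps_recip f\<close> is the inverse of \<open>f\<close> when the constant coefficient is 1, which is
  the only case in which it is used.
\<close>

definition fps_recip :: "int fps \<Rightarrow> int fps" where
  "fps_recip f = fps_right_inverse f 1"

lemma fps_recip:
  assumes "fps_nth f 0 = 1"
  shows "f * fps_recip f = 1" "fps_nth (fps_recip f) 0 = 1"
  using assms by (simp_all add: fps_recip_def fps_right_inverse)

primrec q_frac :: "nat \<Rightarrow> (nat \<Rightarrow> nat) \<Rightarrow> int fps" where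
  "q_frac 0 c = q_nat fps_X (c 0)"
| "q_frac (Suc N) c =
     q_nat fps_X (c 0) - fps_X ^ (c 0 - 1) * fps_recip (q_frac N (\<lambda>j. c (Suc j)))"

text \<open>The topology on formal power series is the q-adic one.\<close>

definition q_real :: "real \<Rightarrow> int fps" where
  "q_real x = lim (\<lambda>N. q_frac N (nc_coeffs x))"

lemma q_nat_fps_nth_0: "2 \<le> n \<Longrightarrow> fps_nth (q_nat (fps_X :: int fps) n) 0 = 1"
proof -
  assume "2 \<le> n"
  then obtain m where "n = Suc m" by (metis Suc_le_D numeral_2_eq_2)
  then show ?thesis
    by (simp add: q_nat_def sum.lessThan_Suc_shift fps_sum_nth)
qed

lemma q_frac_nth_0:
  assumes "\<And>j. 2 \<le> c j"
  shows "fps_nth (q_frac N c) 0 = 1"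
proof (cases N)
  case 0
  then show ?thesis using assms q_nat_fps_nth_0 by simp
next
  case (Suc M)
  have "c 0 - 1 \<noteq> 0" using assms[of 0] by linarith
  then show ?thesis using Suc assms q_nat_fps_nth_0 by simp
qed

lemma q_frac_Suc_dvd:
  assumes "\<And>j. 2 \<le> c j"
  shows "fps_X ^ Suc N dvd q_frac (Suc N) c - q_frac N c"
  using assms
proof (induction N arbitrary: c)
  case 0
  have "fps_X dvd (fps_X :: int fps) ^ (c 0 - 1)"
    using 0[of 0] by (intro dvd_power) auto
  then show ?case by simp
next
  case (Suc N)
  let ?d = "\<lambda>j. c (Suc j)"
  define f where "f = q_frac (Suc N) ?d"
  define g where "g = q_frac N ?d"
  have f: "f * fps_recip f = 1" and g: "g * fps_recip g = 1"
    unfolding f_def g_def by (rule fps_recip(1)[OF q_frac_nth_0]; rule Suc.prems)+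
  have "q_frac (Suc (Suc N)) c - q_frac (Suc N) c
      = fps_X ^ (c 0 - 1) * (fps_recip g - fps_recip f)"
    by (simp only: q_frac.simps(2)[of "Suc N"] q_frac.simps(2)[of N c] f_def[symmetric]
        g_def[symmetric]) (simp add: algebra_simps)
  also have "fps_recip g - fps_recip f = (f * fps_recip f) * fps_recip g - (g * fps_recip g) * fps_recip f"
    by (simp add: f g)
  also have "\<dots> = (f - g) * (fps_recip f * fps_recip g)" by (simp add: algebra_simps)
  finally have eq: "q_frac (Suc (Suc N)) c - q_frac (Suc N) c
      = fps_X ^ (c 0 - 1) * (f - g) * (fps_recip f * fps_recip g)" by (simp only: mult.assoc)
  have "fps_X dvd (fps_X :: int fps) ^ (c 0 - 1)"
    using Suc.prems[of 0] by (intro dvd_power) auto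
  moreover have "fps_X ^ Suc N dvd f - g"
    unfolding f_def g_def by (rule Suc.IH) (rule Suc.prems)
  ultimately have "fps_X * fps_X ^ Suc N dvd fps_X ^ (c 0 - 1) * (f - g)"
    by (rule mult_dvd_mono)
  then show ?case unfolding eq by (simp only: power_Suc[symmetric] dvd_mult2)
qed

lemma q_frac_convergent:
  assumes "\<And>j. 2 \<le> c j"
  shows "convergent (\<lambda>N. q_frac N c)"
proof -
  have step: "fps_nth (q_frac (Suc N) c) n = fps_nth (q_frac N c) n" if "n \<le> N" for n N
  proof -
    obtain h where h: "q_frac (Suc N) c - q_frac N c = fps_X ^ Suc N * h"
      by (rule dvdE[OF q_frac_Suc_dvd[where N = N and c = c]]) (rule assms)
    have "fps_nth (q_frac (Suc N) c - q_frac N c) n = 0"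
      unfolding h fps_X_power_mult_nth using that by simp
    then show ?thesis by simp
  qed
  have stable: "fps_nth (q_frac N c) n = fps_nth (q_frac n c) n" if "n \<le> N" for n N
    using that by (induction rule: dec_induct) (simp_all add: step del: q_frac.simps)
  have "(\<lambda>N. q_frac N c) \<longlonglongrightarrow> Abs_fps (\<lambda>n. fps_nth (q_frac n c) n)"
  proof (rule tendsto_fpsI)
    fix n
    have "\<forall>\<^sub>F N in sequentially. fps_nth (q_frac N c) n = fps_nth (q_frac n c) n"
      using eventually_ge_at_top[of n] by (rule eventually_mono) (rule stable)
    then show "\<forall>\<^sub>F N in sequentially. fps_nth (q_frac N c) n
        = fps_nth (Abs_fps (\<lambda>n. fps_nth (q_frac n c) n)) n"
      unfolding fps_nth_Abs_fps .
  qed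
  then show ?thesis by (rule convergentI)
qed

lemma q_real_LIMSEQ:
  assumes "1 \<le> x"
  shows "(\<lambda>N. q_frac N (nc_coeffs x)) \<longlonglongrightarrow> q_real x"
proof -
  have "2 \<le> nc_coeffs x j" for j
    using nc_expansion_nc_coeffs[OF assms] by (simp add: nc_expansion_def)
  then have "convergent (\<lambda>N. q_frac N (nc_coeffs x))" by (rule q_frac_convergent)
  then show ?thesis unfolding q_real_def by (simp only: convergent_LIMSEQ_iff)
qed


subsection \<open>Values of q-real numbers at real points, real analyticity\<close>

definition R_star :: real where
  "R_star = (3 - sqrt 5) / 2"

definition q_real_at :: "real \<Rightarrow> real \<Rightarrow> real" where
  "q_real_at x q = 1 / (\<Sum>N. q_term (nc_coeffs x) q N)"

definition real_analytic_on :: "(real \<Rightarrow> real) \<Rightarrow> real set \<Rightarrow> bool" where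
  "real_analytic_on f S \<longleftrightarrow>
     (\<forall>t\<in>S. \<exists>r>0. \<exists>b. \<forall>s. \<bar>s - t\<bar> < r \<longrightarrow> (\<lambda>n. b n * (s - t) ^ n) sums f s)"

end

theory Submission
  imports Defs
begin

text \<open>
  Write $a_N$ for \<open>q_denom c q N\<close> and $p_N = q^{c_N - 1}$, with coefficients indexed from 0.
  The numbers $u_0 = 0$, $u_{N+1} = p_N a_N / a_{N+1}$ satisfy
  $a_{N+1} = ([c_N]_q - u_N) a_N$ and $u_{N+1} = f_N(u_N)$, where $f_N$ is the Moebius map
  $u \mapsto p_N / ([c_N]_q - u)$.  Hence
  $q^{C_N} / a_N^2$ is the product of the $p_j / ([c_j]_q - u_j)^2$, that is, the derivative at 0 of the
  composition $f_{N-1} \circ \cdots \circ f_0$, and the $N$-th term of the series is this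
  derivative divided by $[c_N]_q - u_N$.  So the series converges geometrically as soon as
  the maps $f_N$ contract uniformly.

  They do so in the hyperbolic metric of a half-plane $\{\mathrm{Re}\, u < \beta\}$ whenever
  each of them sends this half-plane into a smaller one; the rate is uniform because the orbit stays
  bounded.  If $\mathrm{Re}\, [c]_q > \beta$, the image of the half-plane under
  $u \mapsto p / ([c]_q - u)$ is a disc, and it lies in
  $\{\mathrm{Re}\, u < \beta\}$ with room to spare precisely when
  $(|p| + \mathrm{Re}\, p) / 2 + \epsilon \le \beta (\mathrm{Re}\, [c]_q - \beta)$ for some
  $\epsilon > 0$; this is the condition of the
  parabola theorems for continued fractions.  The contraction follows from one
  perfect square (\<open>half_plane_contraction\<close>), and \<open>q_denom_invariant\<close> iterates it.

  The neighbourhood \<open>parabolic_domain\<close> consists of all \<open>q\<close> in the unit disc that satisfy this condition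
  for some $\beta$ and $\epsilon$ and for all $c \ge 2$ simultaneously, so it does not involve \<open>x\<close>.
  It is open because $[c]_q$ and $q^{c-1}$ are Lipschitz in \<open>q\<close> on smaller discs with a constant
  that does not involve $c$ (\<open>parabolic_near\<close>).  It contains the real interval: for
  $q \ge 0$ the hardest coefficient is 2 and $\beta = [2]_q / 2$ works; for negative $q = -s$ it is 3, where
  $p = s^2$ is positive, and $\beta = [3]_q / 2$ works exactly as long as
  $[3]_q > 2 s$, that is $s^2 - 3 s + 1 > 0$, that is $s < R_*$.

  The partial sums telescope by the Casoratian identity for the two solutions $a_N$ and $b_N$ of
  the recurrence; they are the reciprocals of the truncated fractions.  This gives the identity of
  formal power series.  For real \<open>q\<close> it gives positivity, because the recursion
  $V \mapsto 1 / ([c]_q - p V)$ of the reciprocals maps the interval $(0, 1/\beta)$ into itself.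
\<close>

section \<open>Continuants\<close>

text \<open>
  The polynomials are defined by expanding the fraction at its last coefficient, whereas truncated
  fractions are defined by recursion on the first one.  The continuant can be expanded at either end.
\<close>

lemma q_denom_first_step:
  "q_denom c q (Suc (Suc N)) = q_nat q (c 0) * q_denom (\<lambda>j. c (Suc j)) q (Suc N)
     - q ^ (c 0 - 1) * q_denom (\<lambda>j. c (Suc (Suc j))) q N"
proof (induction N rule: induct_nat_012)
  case (ge2 N)
  then show ?case
    by (simp only: q_denom.simps(3)[of c _ "Suc (Suc N)"]
        q_denom.simps(3)[of "\<lambda>j. c (Suc j)" _ "Suc N"]
        q_denom.simps(3)[of "\<lambda>j. c (Suc (Suc j))" _ N]) (simp only: algebra_simps)
qed (simp_all add: algebra_simps)

text \<open>
  The numerators of the reciprocal fractions are the continuants of the shifted sequence.  They satisfy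
  the same recurrence as the denominators, so the determinant of the two solutions gains
  a factor $q^{c_N - 1}$ in each step.
\<close>

lemma q_denom_casoratian:
  "q_denom (\<lambda>j. c (Suc j)) q (Suc N) * q_denom c q (Suc N)
     - q_denom (\<lambda>j. c (Suc j)) q N * q_denom c q (Suc (Suc N)) = q ^ C_exp c (Suc N)"
proof (induction N)
  case 0
  then show ?case by (simp add: C_exp_def algebra_simps)
next
  case (Suc N)
  have "q_denom (\<lambda>j. c (Suc j)) q (Suc (Suc N)) * q_denom c q (Suc (Suc N))
     - q_denom (\<lambda>j. c (Suc j)) q (Suc N) * q_denom c q (Suc (Suc (Suc N)))
     = q ^ (c (Suc N) - 1) * (q_denom (\<lambda>j. c (Suc j)) q (Suc N) * q_denom c q (Suc N)
     - q_denom (\<lambda>j. c (Suc j)) q N * q_denom c q (Suc (Suc N)))"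
    by (simp only: q_denom.simps(3)[of c _ "Suc N"]
        q_denom.simps(3)[of "\<lambda>j. c (Suc j)" _ N]) (simp only: algebra_simps)
  also have "\<dots> = q ^ C_exp c (Suc (Suc N))"
    unfolding Suc.IH by (simp add: C_exp_def power_add)
  finally show ?case .
qed

lemma sum_q_term:
  fixes q :: "'a::field"
  assumes "\<And>n. q_denom c q n \<noteq> 0"
  shows "(\<Sum>n<Suc N. q_term c q n) = q_denom (\<lambda>j. c (Suc j)) q N / q_denom c q (Suc N)"
proof (induction N)
  case 0
  then show ?case by (simp add: q_term_def C_exp_def)
next
  case (Suc N)
  have "q_term c q (Suc N) = (q_denom (\<lambda>j. c (Suc j)) q (Suc N) * q_denom c q (Suc N)
     - q_denom (\<lambda>j. c (Suc j)) q N * q_denom c q (Suc (Suc N)))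
     / (q_denom c q (Suc N) * q_denom c q (Suc (Suc N)))"
    unfolding q_denom_casoratian q_term_def ..
  also have "\<dots> = q_denom (\<lambda>j. c (Suc j)) q (Suc N) / q_denom c q (Suc (Suc N))
     - q_denom (\<lambda>j. c (Suc j)) q N / q_denom c q (Suc N)"
    using assms[of "Suc N"] assms[of "Suc (Suc N)"] by (simp add: divide_simps del: q_denom.simps)
  finally show ?case using Suc.IH by simp
qed

section \<open>The identity between formal power series\<close>

lemma q_denom_fps_nth_0:
  assumes "\<And>j. 2 \<le> c j"
  shows "fps_nth (q_denom c (fps_X :: int fps) N) 0 = 1"
proof (induction N rule: induct_nat_012)
  case (ge2 N)
  have "c N - 1 \<noteq> 0" using assms[of N] by linarith
  then show ?case using ge2 assms q_nat_fps_nth_0 by simp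
qed (simp_all add: assms q_nat_fps_nth_0)

lemma fps_recip_mult:
  assumes "fps_nth f 0 = 1" "fps_nth g 0 = 1"
  shows "fps_recip (f * g) = fps_recip f * fps_recip g"
proof -
  have fg: "fps_nth (f * g) 0 = 1" using assms by simp
  have "fps_recip (f * g) = fps_recip (f * g) * ((f * fps_recip f) * (g * fps_recip g))"
    by (simp add: fps_recip assms)
  also have "\<dots> = (f * g * fps_recip (f * g)) * (fps_recip f * fps_recip g)"
    by (simp add: mult_ac)
  finally show ?thesis by (simp only: fps_recip(1)[OF fg] mult_1_left)
qed

text \<open>
  Stated without a division: the truncated fraction is a quotient of two continuants, and both recurse
  on the first coefficient.
\<close>

lemma q_frac_eq_quotient:
  assumes "\<And>j. 2 \<le> c j"
  shows "q_frac N c * q_denom (\<lambda>j. c (Suc j)) fps_X N = q_denom c fps_X (Suc N)"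
  using assms
proof (induction N arbitrary: c)
  case 0
  then show ?case by simp
next
  case (Suc N)
  let ?d = "\<lambda>j. c (Suc j)" and ?e = "\<lambda>j. c (Suc (Suc j))"
  have IH: "q_denom ?d fps_X (Suc N) = q_frac N ?d * q_denom ?e fps_X N"
    using Suc.IH[of ?d] Suc.prems by simp
  have r: "q_frac N ?d * fps_recip (q_frac N ?d) = 1"
    using Suc.prems by (intro fps_recip(1) q_frac_nth_0)
  have "fps_recip (q_frac N ?d) * q_denom ?d fps_X (Suc N)
      = (q_frac N ?d * fps_recip (q_frac N ?d)) * q_denom ?e fps_X N"
    unfolding IH by (simp only: mult_ac)
  then have "fps_recip (q_frac N ?d) * q_denom ?d fps_X (Suc N) = q_denom ?e fps_X N"
    unfolding r by simp
  then show ?case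
    by (simp only: q_denom_first_step q_frac.simps left_diff_distrib mult.assoc)
qed

lemma fps_recip_q_frac:
  assumes "\<And>j. 2 \<le> c j"
  shows "fps_recip (q_frac N c)
    = q_denom (\<lambda>j. c (Suc j)) fps_X N * fps_recip (q_denom c fps_X (Suc N))"
proof -
  let ?d = "q_denom (\<lambda>j. c (Suc j)) (fps_X :: int fps) N"
  have d0: "fps_nth ?d 0 = 1" by (rule q_denom_fps_nth_0) (rule assms)
  have "?d * fps_recip (q_frac N c * ?d) = fps_recip (q_frac N c) * (?d * fps_recip ?d)"
    using assms by (simp only: fps_recip_mult[OF q_frac_nth_0 d0] mult_ac)
  then show ?thesis
    using assms by (simp add: q_frac_eq_quotient fps_recip(1)[OF d0] del: q_denom.simps)
qed

text \<open>
  The counterpart of \<open>sum_q_term\<close> over the integers, where the quotients are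
  products with inverses of units.
\<close>

lemma sum_fps_q_term:
  fixes c :: "nat \<Rightarrow> nat"
  assumes "\<And>j. 2 \<le> c j"
  shows "(\<Sum>n<Suc N. fps_X ^ C_exp c n * fps_recip (q_denom c fps_X n * q_denom c fps_X (Suc n)))
    = fps_recip (q_frac N c)"
proof (induction N)
  case 0
  then show ?case by (simp add: C_exp_def)
next
  case (Suc N)
  let ?a = "q_denom c (fps_X :: int fps)" and ?b = "q_denom (\<lambda>j. c (Suc j)) (fps_X :: int fps)"
  have r: "?a n * fps_recip (?a n) = 1" for n
    using assms by (intro fps_recip(1) q_denom_fps_nth_0)
  have "fps_X ^ C_exp c (Suc N) * fps_recip (?a (Suc N) * ?a (Suc (Suc N)))
     = (?b (Suc N) * ?a (Suc N) - ?b N * ?a (Suc (Suc N)))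
        * (fps_recip (?a (Suc N)) * fps_recip (?a (Suc (Suc N))))"
    unfolding q_denom_casoratian
    using assms by (simp only: fps_recip_mult q_denom_fps_nth_0)
  also have "\<dots> = ?b (Suc N) * fps_recip (?a (Suc (Suc N))) * (?a (Suc N) * fps_recip (?a (Suc N)))
      - ?b N * fps_recip (?a (Suc N)) * (?a (Suc (Suc N)) * fps_recip (?a (Suc (Suc N))))"
    by (simp only: algebra_simps)
  also have "\<dots> = fps_recip (q_frac (Suc N) c) - fps_recip (q_frac N c)"
    unfolding r fps_recip_q_frac[OF assms] by simp
  finally show ?case using Suc.IH by simp
qed

text \<open>
  Each coefficient of the inverse involves only finitely many coefficients of the series, and
  each of those is eventually constant.
\<close>

lemma tendsto_fps_recip:
  assumes lim: "f \<longlonglongrightarrow> g" and f0: "\<And>N. fps_nth (f N) 0 = 1"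
  shows "(\<lambda>N. fps_recip (f N)) \<longlonglongrightarrow> fps_recip g"
proof (rule tendsto_fpsI)
  fix n
  have ev: "\<forall>\<^sub>F N in sequentially. fps_nth (f N) k = fps_nth g k" for k
    using lim by (simp add: tendsto_fps_iff)
  have g0: "fps_nth g 0 = 1"
    using eventually_happens'[OF sequentially_bot ev[of 0]] f0 by auto
  have "\<forall>\<^sub>F N in sequentially. \<forall>k\<in>{..n}. fps_nth (f N) k = fps_nth g k"
    by (intro eventually_ball_finite) (auto simp: ev)
  then show "\<forall>\<^sub>F N in sequentially. fps_nth (fps_recip (f N)) n = fps_nth (fps_recip g) n"
  proof eventually_elim
    case (elim N)
    have "fps_recip (f N) - fps_recip g
        = fps_recip (f N) * (g * fps_recip g) - fps_recip g * (f N * fps_recip (f N))"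
      by (simp add: fps_recip f0 g0)
    also have "\<dots> = (g - f N) * (fps_recip (f N) * fps_recip g)" by (simp add: algebra_simps)
    finally have "fps_nth (fps_recip (f N) - fps_recip g) n = 0"
      using elim by (simp add: fps_mult_nth)
    then show ?case by simp
  qed
qed

lemma fps_q_term_sums:
  assumes "1 \<le> x"
  shows "(\<lambda>N. fps_X ^ C_exp (nc_coeffs x) N *
           fps_recip (q_denom (nc_coeffs x) fps_X N * q_denom (nc_coeffs x) fps_X (Suc N)))
        sums fps_recip (q_real x)"
proof -
  have c: "\<And>j. 2 \<le> nc_coeffs x j"
    using nc_expansion_nc_coeffs[OF assms] by (simp add: nc_expansion_def)
  have "(\<lambda>N. fps_recip (q_frac N (nc_coeffs x))) \<longlonglongrightarrow> fps_recip (q_real x)"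
    by (intro tendsto_fps_recip q_real_LIMSEQ assms q_frac_nth_0 c)
  then show ?thesis
    unfolding sums_def sum_fps_q_term[OF c, symmetric] by (rule LIMSEQ_imp_Suc)
qed

section \<open>Contraction of a half-plane\<close>

text \<open>
  This is the Schwarz-Pick inequality, with a gain, for the map $w \mapsto w' = \beta - p / (k + w)$ of the right
  half-plane (so $w = \beta - u$ and $k = [c]_q - \beta$).  The hyperbolic density at $w$ is
  $1 / \mathrm{Re}\, w$ and the derivative has modulus $|p| / |k + w|^2$; without the summand
  $\epsilon / \beta$ the inequality says that the map does not expand, and the summand is what makes it
  contract on sets where $\mathrm{Re}\, w$ is bounded.  In the extreme
  case $\beta\, \mathrm{Re}\, k = (|p| + \mathrm{Re}\, p) / 2$ and $\epsilon = 0$, the difference of the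
  two sides, multiplied by $\beta$, is the square of the modulus of $\beta (k + w) - (p + |p|) / 2$.
\<close>

lemma half_plane_contraction:
  fixes p k w :: complex
  assumes \<beta>: "0 < \<beta>" and k: "(norm p + Re p) / 2 + \<epsilon> \<le> \<beta> * Re k" and k0: "0 < Re (k + w)"
  shows "norm p * (Re w + \<epsilon> / \<beta>) \<le> (norm (k + w))\<^sup>2 * Re (of_real \<beta> - p / (k + w))"
proof -
  define z where "z = k + w"
  have z: "z \<noteq> 0" using k0 unfolding z_def by (metis less_irrefl zero_complex.sel(1))
  have "0 \<le> (norm (of_real \<beta> * z - (p + of_real (norm p)) / 2))\<^sup>2" by simp
  also have "\<dots> = \<beta> * (\<beta> * (norm z)\<^sup>2 - Re (p * cnj z)) - norm p * \<beta> * Re z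
      + norm p * ((norm p + Re p) / 2)"
  proof -
    have n: "(norm p)\<^sup>2 = (Re p)\<^sup>2 + (Im p)\<^sup>2" by (rule cmod_power2)
    have "(norm (of_real \<beta> * z - (p + of_real (norm p)) / 2))\<^sup>2
       = (\<beta> * Re z - (Re p + norm p) / 2)\<^sup>2 + (\<beta> * Im z - Im p / 2)\<^sup>2"
      by (simp add: cmod_power2)
    also have "\<dots> = \<beta> * (\<beta> * ((Re z)\<^sup>2 + (Im z)\<^sup>2) - (Re p * Re z + Im p * Im z)) - norm p * \<beta> * Re z
      + (((Re p)\<^sup>2 + (Im p)\<^sup>2) + 2 * norm p * Re p + (norm p)\<^sup>2) / 4"
      by (simp add: power2_eq_square field_simps)
    also have "(((Re p)\<^sup>2 + (Im p)\<^sup>2) + 2 * norm p * Re p + (norm p)\<^sup>2) / 4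
        = norm p * ((norm p + Re p) / 2)"
      unfolding n[symmetric] by (simp add: power2_eq_square field_simps)
    finally show ?thesis by (simp add: cmod_power2)
  qed
  also have "norm p * ((norm p + Re p) / 2) \<le> norm p * (\<beta> * Re k - \<epsilon>)"
    using k by (intro mult_left_mono) (linarith, simp)
  finally have "norm p * (\<beta> * Re w + \<epsilon>) \<le> \<beta> * (\<beta> * (norm z)\<^sup>2 - Re (p * cnj z))"
    by (simp add: z_def algebra_simps)
  then have "norm p * (Re w + \<epsilon> / \<beta>) \<le> \<beta> * (norm z)\<^sup>2 - Re (p * cnj z)"
    using \<beta> by (simp add: field_simps)
  also have "\<dots> = (norm z)\<^sup>2 * Re (of_real \<beta> - p / z)"
  proof -
    have "(norm z)\<^sup>2 * Re (p / z) = Re (p * cnj z)"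
      using z unfolding complex_div_cnj[of p z] by simp
    then show ?thesis by (simp add: algebra_simps)
  qed
  finally show ?thesis by (simp add: z_def)
qed

text \<open>
  The two parameters are explicit because all later estimates are uniform in \<open>q\<close> and \<open>c\<close> once they are
  fixed.
\<close>

definition parabolic :: "real \<Rightarrow> real \<Rightarrow> complex \<Rightarrow> bool" where
  "parabolic \<beta> \<epsilon> q \<longleftrightarrow> 0 < \<beta> \<and> 0 < \<epsilon> \<and> norm q < 1 \<and>
     (\<forall>c\<ge>2. (norm (q ^ (c - 1)) + Re (q ^ (c - 1))) / 2 + \<epsilon> \<le> \<beta> * (Re (q_nat q c) - \<beta>))"

lemma parabolicD:
  assumes "parabolic \<beta> \<epsilon> q"
  shows "0 < \<beta>" "0 < \<epsilon>" "norm q < 1"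
    and "2 \<le> c \<Longrightarrow>
      (norm (q ^ (c - 1)) + Re (q ^ (c - 1))) / 2 + \<epsilon> \<le> \<beta> * (Re (q_nat q c) - \<beta>)"
    and "2 \<le> c \<Longrightarrow> \<epsilon> / \<beta> \<le> Re (q_nat q c) - \<beta>"
proof -
  show \<beta>: "0 < \<beta>" and "0 < \<epsilon>" "norm q < 1" using assms by (simp_all add: parabolic_def)
  assume c: "2 \<le> c"
  show *: "(norm (q ^ (c - 1)) + Re (q ^ (c - 1))) / 2 + \<epsilon> \<le> \<beta> * (Re (q_nat q c) - \<beta>)"
    using assms c unfolding parabolic_def by blast
  have "0 \<le> norm (q ^ (c - 1)) + Re (q ^ (c - 1))"
    using abs_Re_le_cmod[of "q ^ (c - 1)"] by linarith
  with * have "\<epsilon> \<le> \<beta> * (Re (q_nat q c) - \<beta>)" by argo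
  then show "\<epsilon> / \<beta> \<le> Re (q_nat q c) - \<beta>" using \<beta> by (simp add: pos_divide_le_eq mult.commute)
qed

text \<open>The orbit $u_N$ of 0 under the Moebius maps, written in terms of the continuants.\<close>

definition q_tail :: "(nat \<Rightarrow> nat) \<Rightarrow> 'a::field \<Rightarrow> nat \<Rightarrow> 'a" where
  "q_tail c q N = (case N of 0 \<Rightarrow> 0
     | Suc n \<Rightarrow> q ^ (c n - 1) * q_denom c q n / q_denom c q (Suc n))"

lemma q_denom_Suc:
  assumes "q_denom c q N \<noteq> 0"
  shows "q_denom c q (Suc N) = (q_nat q (c N) - q_tail c q N) * q_denom c q N"
  using assms by (cases N) (simp_all add: q_tail_def algebra_simps)

lemma q_tail_Suc:
  assumes "q_denom c q N \<noteq> 0"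
  shows "q_tail c q (Suc N) = q ^ (c N - 1) / (q_nat q (c N) - q_tail c q N)"
  using assms by (simp add: q_tail_def[of _ _ "Suc N"] q_denom_Suc del: q_denom.simps)

text \<open>
  The ratio $M / (M + \epsilon / \beta)$ with $M = \beta + \beta / \epsilon$: in
  \<open>half_plane_contraction\<close> the real part of $w$ is traded for
  $\mathrm{Re}\, w + \epsilon / \beta$, and $M$ bounds $\mathrm{Re}\, w$ along the orbit, since $|u|$ is at most
  $|p| / \mathrm{Re}\, k \le \beta / \epsilon$.
\<close>

definition q_rate :: "real \<Rightarrow> real \<Rightarrow> real" where
  "q_rate \<beta> \<epsilon> = (\<beta> + \<beta> / \<epsilon>) / (\<beta> + \<beta> / \<epsilon> + \<epsilon> / \<beta>)"

text \<open>
  The last conjunct is the derivative at 0 of the iterated map, measured in the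
  hyperbolic densities $1 / \beta$ at the start and $1 / \mathrm{Re} (\beta - u_N)$ at the end.
\<close>

lemma q_denom_invariant:
  assumes par: "parabolic \<beta> \<epsilon> q" and c: "\<And>j. 2 \<le> c j"
  shows "q_denom c q N \<noteq> 0 \<and> 0 < Re (of_real \<beta> - q_tail c q N)
    \<and> Re (of_real \<beta> - q_tail c q N) \<le> \<beta> + \<beta> / \<epsilon>
    \<and> norm (q ^ C_exp c N) / (norm (q_denom c q N))\<^sup>2
        \<le> q_rate \<beta> \<epsilon> ^ N * (Re (of_real \<beta> - q_tail c q N) / \<beta>)"
proof (induction N)
  case 0
  then show ?case using parabolicD[OF par] by (simp add: q_tail_def C_exp_def)
next
  case (Suc N)
  define p where "p = q ^ (c N - 1)"
  define w where "w = of_real \<beta> - q_tail c q N"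
  define k where "k = q_nat q (c N) - of_real \<beta>"
  define w' where "w' = of_real \<beta> - p / (k + w)"
  define \<eta> where "\<eta> = \<epsilon> / \<beta>"
  define M where "M = \<beta> + \<beta> / \<epsilon>"
  let ?l = "q_rate \<beta> \<epsilon>"
  have pos: "0 < \<beta>" "0 < \<epsilon>" "0 < \<eta>" "0 < M" and q1: "norm q < 1"
    using parabolicD[OF par] by (auto simp: \<eta>_def M_def intro: add_pos_pos)
  have \<lambda>: "?l = M / (M + \<eta>)" by (simp add: q_rate_def M_def \<eta>_def)
  have a: "q_denom c q N \<noteq> 0" and w: "0 < Re w" "Re w \<le> M"
    and IH: "norm (q ^ C_exp c N) / (norm (q_denom c q N))\<^sup>2 \<le> ?l ^ N * (Re w / \<beta>)"
    using Suc.IH by (auto simp: w_def M_def)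
  have k: "\<eta> \<le> Re k" "(norm p + Re p) / 2 + \<epsilon> \<le> \<beta> * Re k"
    using parabolicD(4,5)[OF par c[of N]] by (simp_all add: k_def p_def \<eta>_def)
  have z: "q_nat q (c N) - q_tail c q N = k + w" by (simp add: k_def w_def)
  have tail: "of_real \<beta> - q_tail c q (Suc N) = w'"
    unfolding q_tail_Suc[OF a] z w'_def p_def ..
  have Rez: "\<eta> \<le> Re (k + w)" "0 < Re (k + w)" using k w pos by auto
  then have nz: "\<eta> \<le> norm (k + w)" using complex_Re_le_cmod[of "k + w"] by linarith
  have z0: "k + w \<noteq> 0" using nz pos by auto
  have contr: "norm p * (Re w + \<eta>) \<le> (norm (k + w))\<^sup>2 * Re w'"
    unfolding w'_def \<eta>_def by (rule half_plane_contraction) (use pos k Rez in auto)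
  have w'0: "0 < Re w'"
  proof (cases "p = 0")
    case True
    then show ?thesis using pos by (simp add: w'_def)
  next
    case False
    then have "0 < norm p * (Re w + \<eta>)" using w pos by simp
    then have "0 < (norm (k + w))\<^sup>2 * Re w'" using contr by linarith
    then show ?thesis by (simp add: zero_less_mult_iff)
  qed
  have w'M: "Re w' \<le> M"
  proof -
    have "norm p \<le> 1" unfolding p_def norm_power using q1 by (intro power_le_one) auto
    then have "norm (p / (k + w)) \<le> 1 / \<eta>"
      unfolding norm_divide using nz pos by (intro frac_le) auto
    then have "- Re (p / (k + w)) \<le> 1 / \<eta>"
      using abs_Re_le_cmod[of "p / (k + w)"] by linarith
    then show ?thesis by (simp add: w'_def M_def \<eta>_def)
  qed
  have "Re w * \<eta> \<le> M * \<eta>" using w pos by (intro mult_right_mono) auto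
  then have "Re w \<le> ?l * (Re w + \<eta>)"
    unfolding \<lambda> using pos by (simp add: pos_le_divide_eq algebra_simps)
  then have "norm p * Re w \<le> ?l * (norm p * (Re w + \<eta>))"
    using mult_left_mono[of "Re w" "?l * (Re w + \<eta>)" "norm p"] by (simp add: mult.left_commute)
  also have "\<dots> \<le> ?l * ((norm (k + w))\<^sup>2 * Re w')"
    using contr pos \<lambda> by (intro mult_left_mono) auto
  finally have step: "norm p * Re w / (norm (k + w))\<^sup>2 \<le> ?l * Re w'"
    using z0 by (simp add: pos_divide_le_eq mult_ac)
  have "norm (q ^ C_exp c (Suc N)) / (norm (q_denom c q (Suc N)))\<^sup>2
      = norm (q ^ C_exp c N) / (norm (q_denom c q N))\<^sup>2 * (norm p / (norm (k + w))\<^sup>2)"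
    unfolding q_denom_Suc[OF a] z
    by (simp add: C_exp_def power_add norm_mult power_mult_distrib p_def mult_ac)
  also have "\<dots> \<le> ?l ^ N * (Re w / \<beta>) * (norm p / (norm (k + w))\<^sup>2)"
    using IH by (intro mult_right_mono) auto
  also have "\<dots> = ?l ^ N / \<beta> * (norm p * Re w / (norm (k + w))\<^sup>2)" by simp
  also have "\<dots> \<le> ?l ^ N / \<beta> * (?l * Re w')"
    using pos \<lambda> by (intro mult_left_mono[OF step]) auto
  finally have "norm (q ^ C_exp c (Suc N)) / (norm (q_denom c q (Suc N)))\<^sup>2
      \<le> ?l ^ Suc N * (Re w' / \<beta>)" by (simp add: mult_ac)
  moreover have "q_denom c q (Suc N) \<noteq> 0"
    unfolding q_denom_Suc[OF a] z using z0 a by simp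
  ultimately show ?case using w'0 w'M unfolding tail M_def by blast
qed

lemma norm_q_term_le:
  assumes par: "parabolic \<beta> \<epsilon> q" and c: "\<And>j. 2 \<le> c j"
  shows "norm (q_term c q N) \<le> q_rate \<beta> \<epsilon> ^ N * ((\<beta> + \<beta> / \<epsilon>) / \<epsilon>)"
proof -
  define z where "z = q_nat q (c N) - q_tail c q N"
  have pos: "0 < \<beta>" "0 < \<epsilon>" using parabolicD[OF par] by auto
  have rate: "0 \<le> q_rate \<beta> \<epsilon>" using pos by (simp add: q_rate_def)
  note inv = q_denom_invariant[where c = c and N = N, OF par c]
  then have a: "q_denom c q N \<noteq> 0" by blast
  have "\<epsilon> / \<beta> \<le> Re z"
    using parabolicD(5)[OF par c[of N]] inv by (simp add: z_def)
  then have z: "\<epsilon> / \<beta> \<le> norm z" using complex_Re_le_cmod[of z] by linarith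
  have "norm (q_term c q N) = norm (q ^ C_exp c N) / (norm (q_denom c q N))\<^sup>2 / norm z"
    unfolding q_term_def q_denom_Suc[OF a]
    by (simp add: norm_mult norm_divide z_def power2_eq_square mult_ac)
  also have "\<dots> \<le> q_rate \<beta> \<epsilon> ^ N * ((\<beta> + \<beta> / \<epsilon>) / \<beta>) / (\<epsilon> / \<beta>)"
  proof (rule frac_le[OF _ _ _ z])
    have "q_rate \<beta> \<epsilon> ^ N * (Re (of_real \<beta> - q_tail c q N) / \<beta>)
        \<le> q_rate \<beta> \<epsilon> ^ N * ((\<beta> + \<beta> / \<epsilon>) / \<beta>)"
      using inv pos rate by (intro mult_left_mono divide_right_mono) auto
    then show "norm (q ^ C_exp c N) / (norm (q_denom c q N))\<^sup>2
        \<le> q_rate \<beta> \<epsilon> ^ N * ((\<beta> + \<beta> / \<epsilon>) / \<beta>)"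
      using inv by linarith
  qed (use pos rate in auto)
  also have "\<dots> = q_rate \<beta> \<epsilon> ^ N * ((\<beta> + \<beta> / \<epsilon>) / \<epsilon>)" using pos by simp
  finally show ?thesis .
qed

lemma q_rate_bounds:
  assumes "0 < \<beta>" "0 < \<epsilon>"
  shows "0 \<le> q_rate \<beta> \<epsilon>" "q_rate \<beta> \<epsilon> < 1"
  using assms by (auto simp: q_rate_def pos_divide_less_eq add_pos_pos)

section \<open>Stability of the half-plane condition\<close>

text \<open>
  On a disc of radius less than 1 the Lipschitz constants of the powers and of the \<open>q\<close>-integers
  are bounded independently of the exponent.  This is what makes one neighbourhood serve all
  coefficient sequences.
\<close>

lemma norm_power_diff_le:
  fixes x y :: "'a::{real_normed_field}"
  assumes "norm x \<le> r" "norm y \<le> r" "r < 1"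
  shows "norm (x ^ n - y ^ n) \<le> norm (x - y) / (1 - r)"
proof (cases n)
  case 0
  then show ?thesis using assms by simp
next
  case (Suc m)
  have r0: "0 \<le> r" using assms(1) norm_ge_zero order_trans by blast
  have "norm (\<Sum>i<Suc m. x ^ i * y ^ (m - i)) \<le> (\<Sum>i<Suc m. r ^ i)"
  proof (rule sum_norm_le)
    fix i
    have "norm (x ^ i * y ^ (m - i)) \<le> r ^ i * 1"
      unfolding norm_mult norm_power using assms r0
      by (intro mult_mono power_mono power_le_one) auto
    then show "norm (x ^ i * y ^ (m - i)) \<le> r ^ i" by simp
  qed
  also have "\<dots> = (1 - r ^ Suc m) / (1 - r)"
    using assms by (simp only: sum_gp_strict) simp
  also have "\<dots> \<le> 1 / (1 - r)" using assms r0 by (intro divide_right_mono) auto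
  finally have "norm (x - y) * norm (\<Sum>i<Suc m. x ^ i * y ^ (m - i)) \<le> norm (x - y) * (1 / (1 - r))"
    by (intro mult_left_mono) auto
  then show ?thesis unfolding Suc diff_power_eq_sum norm_mult by simp
qed

lemma norm_q_nat_diff_le:
  fixes x y :: "'a::{real_normed_field}"
  assumes "norm x \<le> r" "norm y \<le> r" "r < 1"
  shows "norm (q_nat x n - q_nat y n) \<le> 2 * norm (x - y) / (1 - r)\<^sup>2"
proof -
  have r0: "0 \<le> r" using assms(1) norm_ge_zero order_trans by blast
  have "norm (q_nat y n) \<le> (\<Sum>i<n. r ^ i)"
    unfolding q_nat_def using assms by (intro sum_norm_le) (simp add: norm_power power_mono)
  also have "\<dots> = (1 - r ^ n) / (1 - r)" using assms by (simp add: sum_gp_strict)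
  also have "\<dots> \<le> 1 / (1 - r)" using assms r0 by (intro divide_right_mono) auto
  finally have y: "norm (q_nat y n) \<le> 1 / (1 - r)" .
  have "1 - r \<le> norm (1 - x)" using norm_triangle_ineq2[of 1 x] assms by simp
  then have "(1 - r) * norm (q_nat x n - q_nat y n) \<le> norm ((1 - x) * (q_nat x n - q_nat y n))"
    unfolding norm_mult by (rule mult_right_mono) simp
  also have "(1 - x) * (q_nat x n - q_nat y n) = (x - y) * q_nat y n + (y ^ n - x ^ n)"
  proof -
    have "(1 - x) * (q_nat x n - q_nat y n)
        = (1 - x) * q_nat x n - (1 - y) * q_nat y n + (x - y) * q_nat y n"
      by (simp add: algebra_simps)
    then show ?thesis by (simp add: q_nat_eq)
  qed
  also have "norm \<dots> \<le> norm (x - y) * norm (q_nat y n) + norm (y ^ n - x ^ n)"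
    by (metis norm_mult norm_triangle_ineq)
  also have "\<dots> \<le> norm (x - y) * (1 / (1 - r)) + norm (x - y) / (1 - r)"
    using norm_power_diff_le[OF assms(2,1,3), of n] y
    by (intro add_mono mult_left_mono) (auto simp: norm_minus_commute)
  finally have "(1 - r) * norm (q_nat x n - q_nat y n) \<le> 2 * norm (x - y) / (1 - r)" by simp
  then have "norm (q_nat x n - q_nat y n) \<le> 2 * norm (x - y) / (1 - r) / (1 - r)"
    using assms(3) by (subst pos_le_divide_eq) (auto simp: mult.commute)
  then show ?thesis by (simp add: power2_eq_square)
qed

text \<open>
  Half of the slack $\epsilon$ pays for the perturbation of \<open>q\<close>, and $\beta$ is kept.
\<close>

lemma parabolic_near:
  assumes par: "parabolic \<beta> \<epsilon> q"
  shows "\<exists>\<delta>>0. \<forall>q'\<in>ball q \<delta>. parabolic \<beta> (\<epsilon> / 2) q'"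
proof -
  note pos = parabolicD(1-3)[OF par]
  define r where "r = (1 + norm q) / 2"
  have r: "r < 1" "norm q \<le> r" using pos by (simp_all add: r_def)
  \<comment> \<open>For $d = |q' - q|$, the left side changes by at most $d / (1 - r)^2$ and the right side by at most
    $2 \beta d / (1 - r)^2$.\<close>
  define \<delta> where "\<delta> = min (r - norm q) (\<epsilon> / 2 * (1 - r)\<^sup>2 / (1 + 2 * \<beta>))"
  have "0 < r - norm q" using pos by (simp add: r_def field_simps)
  then have "0 < \<delta>" using pos r by (auto simp: \<delta>_def)
  moreover have "parabolic \<beta> (\<epsilon> / 2) q'" if "q' \<in> ball q \<delta>" for q'
  proof -
    define d where "d = norm (q' - q)"
    have d: "d < \<delta>" using that by (simp add: d_def dist_norm norm_minus_commute)
    have "norm q' \<le> norm q + d" unfolding d_def by (rule norm_triangle_sub)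
    then have q': "norm q' \<le> r" using d by (simp add: \<delta>_def)
    have "d \<le> \<epsilon> / 2 * (1 - r)\<^sup>2 / (1 + 2 * \<beta>)" using d by (simp add: \<delta>_def)
    then have slack: "d / (1 - r)\<^sup>2 * (1 + 2 * \<beta>) \<le> \<epsilon> / 2"
      using r pos by (simp add: field_simps)
    have "(norm (q' ^ (c - 1)) + Re (q' ^ (c - 1))) / 2 + \<epsilon> / 2 \<le> \<beta> * (Re (q_nat q' c) - \<beta>)"
      if c: "2 \<le> c" for c
    proof -
      let ?p = "q ^ (c - 1)" and ?p' = "q' ^ (c - 1)"
      have "norm (?p' - ?p) \<le> d / (1 - r)"
        unfolding d_def by (rule norm_power_diff_le) (use r q' in auto)
      also have "\<dots> \<le> d / (1 - r)\<^sup>2"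
        using r order_trans[OF norm_ge_zero r(2)]
        by (intro divide_left_mono) (auto simp: power2_eq_square d_def mult_le_cancel_left1)
      finally have dp: "norm (?p' - ?p) \<le> d / (1 - r)\<^sup>2" .
      have "norm ?p' \<le> norm ?p + norm (?p' - ?p)" by (rule norm_triangle_sub)
      moreover have "Re ?p' - Re ?p \<le> norm (?p' - ?p)"
        using complex_Re_le_cmod[of "?p' - ?p"] by simp
      ultimately have 1: "(norm ?p' + Re ?p') / 2 \<le> (norm ?p + Re ?p) / 2 + d / (1 - r)\<^sup>2"
        using dp by argo
      have "norm (q_nat q c - q_nat q' c) \<le> 2 * norm (q - q') / (1 - r)\<^sup>2"
        by (rule norm_q_nat_diff_le) (use r q' in auto)
      then have "Re (q_nat q c) - Re (q_nat q' c) \<le> 2 * d / (1 - r)\<^sup>2"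
        using complex_Re_le_cmod[of "q_nat q c - q_nat q' c"]
        by (simp add: d_def norm_minus_commute)
      then have "\<beta> * (Re (q_nat q c) - Re (q_nat q' c)) \<le> \<beta> * (2 * d / (1 - r)\<^sup>2)"
        using pos by (intro mult_left_mono) auto
      then have 2: "\<beta> * (Re (q_nat q c) - \<beta>) \<le> \<beta> * (Re (q_nat q' c) - \<beta>) + \<beta> * (2 * d / (1 - r)\<^sup>2)"
        by (simp add: algebra_simps)
      have "d / (1 - r)\<^sup>2 * (1 + 2 * \<beta>) = d / (1 - r)\<^sup>2 + \<beta> * (2 * d / (1 - r)\<^sup>2)"
        by (simp add: distrib_left)
      then show ?thesis using 1 2 parabolicD(4)[OF par c] slack by linarith
    qed
    then show ?thesis using pos r q' unfolding parabolic_def by simp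
  qed
  ultimately show ?thesis by (intro exI[of _ \<delta>] conjI ballI)
qed

section \<open>The real interval\<close>

lemma q_nat_of_real:
  "q_nat (of_real q) n = (of_real (q_nat q n) :: 'a::{real_algebra_1,comm_ring_1})"
  by (simp add: q_nat_def)

lemma q_denom_of_real:
  "q_denom c (of_real q) N = (of_real (q_denom c q N) :: 'a::{real_algebra_1,comm_ring_1})"
  by (induction c q N rule: q_denom.induct) (simp_all add: q_nat_of_real)

lemma q_term_of_real:
  "q_term c (of_real q) N = (of_real (q_term c q N) :: 'a::real_field)"
  by (simp add: q_term_def q_denom_of_real)

lemma parabolic_of_real_iff:
  "parabolic \<beta> \<epsilon> (of_real q) \<longleftrightarrow> 0 < \<beta> \<and> 0 < \<epsilon> \<and> \<bar>q\<bar> < 1 \<and>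
     (\<forall>c\<ge>2. max (q ^ (c - 1)) 0 + \<epsilon> \<le> \<beta> * (q_nat q c - \<beta>))"
proof -
  have "(norm (of_real q ^ n :: complex) + Re (of_real q ^ n)) / 2 = max (q ^ n) 0" for n
    unfolding of_real_power[symmetric] norm_of_real Re_complex_of_real by (auto simp: max_def)
  then show ?thesis unfolding parabolic_def q_nat_of_real by simp
qed

text \<open>
  For $q \ge 0$ the right side grows and the left side decreases with the coefficient, so
  only $c = 2$ matters: $\beta (1 + q - \beta) > q$ means $q < \beta < 1$, and
  the midpoint leaves the slack $(1 - q)^2 / 4$.
\<close>

lemma parabolic_nonneg:
  fixes q :: real
  assumes q: "0 \<le> q" "q < 1"
  shows "parabolic ((1 + q) / 2) ((1 - q)\<^sup>2 / 4) (of_real q)"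
  unfolding parabolic_of_real_iff
proof (intro conjI allI impI)
  fix c :: nat
  assume c: "2 \<le> c"
  let ?\<beta> = "(1 + q) / 2"
  have "(\<Sum>i<2. q ^ i) \<le> q_nat q c"
    unfolding q_nat_def using c q by (intro sum_mono2) auto
  then have "1 + q \<le> q_nat q c" by (simp add: numeral_2_eq_2)
  then have "?\<beta> * (1 + q - ?\<beta>) \<le> ?\<beta> * (q_nat q c - ?\<beta>)"
    using q by (intro mult_left_mono) auto
  moreover have "?\<beta> * (1 + q - ?\<beta>) = q + (1 - q)\<^sup>2 / 4"
    by (simp add: power2_eq_square field_simps)
  moreover have "q ^ (c - 1) \<le> q ^ 1" using c q by (intro power_decreasing) auto
  moreover have "max (q ^ (c - 1)) 0 = q ^ (c - 1)" using q by (intro max_absorb1) simp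
  ultimately show "max (q ^ (c - 1)) 0 + (1 - q)\<^sup>2 / 4 \<le> ?\<beta> * (q_nat q c - ?\<beta>)"
    by simp
qed (use q in auto)

lemma q_nat_minus_ge:
  fixes s :: real
  assumes s: "0 < s" "s < 1" and c: "2 \<le> c"
  shows "1 - s \<le> q_nat (- s) c"
proof -
  have "(- s) ^ c \<le> s ^ c" using power_abs[of "- s" c] s by (metis abs_ge_self abs_minus abs_of_pos)
  also have "\<dots> \<le> s ^ 2" using s c by (intro power_decreasing) auto
  finally have "(1 + s) * (1 - s) \<le> (1 + s) * q_nat (- s) c"
    using q_nat_eq[of "- s" c] by (simp add: power2_eq_square algebra_simps)
  then show ?thesis using s by simp
qed

text \<open>
  For negative \<open>q\<close> the coefficient 3 is critical: $\beta ([3]_q - \beta)$ is largest at $\beta = [3]_q / 2$, and there it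
  exceeds $q^2$ exactly when $s < R_*$.  For the other coefficients it is enough that $[c]_q \ge 1 - s$ and
  that the positive part of $q^{c-1}$ is at most $s^4$: the power is negative for $c = 2$ and $c = 4$, and
  has exponent at least 4 from $c = 5$ on.
\<close>

lemma parabolic_neg:
  fixes s :: real
  assumes s: "0 < s" "s < R_star"
  defines "\<beta> \<equiv> (1 - s + s\<^sup>2) / 2"
  obtains \<epsilon> where "parabolic \<beta> \<epsilon> (of_real (- s))"
proof -
  have "2 < sqrt 5" by (rule real_less_rsqrt) simp
  then have half: "s < 1 / 2" using s by (simp add: R_star_def)
  have "sqrt 5 < 3 - 2 * s" using s by (simp add: R_star_def)
  then have "(sqrt 5)\<^sup>2 < (3 - 2 * s)\<^sup>2" by (intro power_strict_mono) auto
  then have quad: "s < (1 - s)\<^sup>2" by (simp add: power2_eq_square algebra_simps)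
  have s2: "s\<^sup>2 < s / 2" using s half by (simp add: power2_eq_square)
  have s4: "s ^ 4 < s / 8"
  proof -
    have "s\<^sup>2 * s\<^sup>2 < (s / 2) * (1 / 4)"
      using s s2 half by (intro mult_strict_mono) auto
    then show ?thesis by (simp add: power_numeral_reduce power2_eq_square mult.assoc)
  qed
  have \<beta>: "0 < \<beta>" using s half by (simp add: \<beta>_def add_pos_nonneg)
  have "s < \<beta>" using quad by (simp add: \<beta>_def power2_eq_square algebra_simps)
  then have gap3: "s\<^sup>2 < \<beta>\<^sup>2" using s by (intro power_strict_mono) auto
  have "\<beta> * (1 - s - \<beta>) = ((1 - s)\<^sup>2 - s ^ 4) / 4"
  proof -
    have "\<beta> * (1 - s - \<beta>) = ((1 - s) + s\<^sup>2) / 2 * (((1 - s) - s\<^sup>2) / 2)"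
      by (simp add: \<beta>_def diff_divide_distrib add_divide_distrib)
    also have "\<dots> = ((1 - s)\<^sup>2 - (s\<^sup>2)\<^sup>2) / 4"
      by (simp add: power2_eq_square[of "1 - s"] power2_eq_square[of "s\<^sup>2"] algebra_simps)
    finally have "\<beta> * (1 - s - \<beta>) = ((1 - s)\<^sup>2 - (s\<^sup>2)\<^sup>2) / 4" .
    then show ?thesis by (simp flip: power_mult)
  qed
  moreover have "5 * s ^ 4 < (1 - s)\<^sup>2"
    using order.strict_trans[OF _ quad, of "5 * s ^ 4"] s4 s(1) by linarith
  ultimately have gap: "s ^ 4 < \<beta> * (1 - s - \<beta>)" by simp
  define \<epsilon> where "\<epsilon> = min (\<beta>\<^sup>2 - s\<^sup>2) (\<beta> * (1 - s - \<beta>) - s ^ 4)"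
  have "max ((- s) ^ (c - 1)) 0 + \<epsilon> \<le> \<beta> * (q_nat (- s) c - \<beta>)" if c: "2 \<le> c" for c
  proof (cases "c = 3")
    case True
    have "q_nat (- s) 3 = 2 * \<beta>"
      by (simp add: q_nat_def numeral_3_eq_3 \<beta>_def power2_eq_square)
    then have "\<beta> * (q_nat (- s) c - \<beta>) = \<beta>\<^sup>2" using True by (simp add: power2_eq_square)
    then show ?thesis using True by (simp add: \<epsilon>_def)
  next
    case False
    have "(- s) ^ (c - 1) \<le> s ^ 4"
    proof (cases "c = 2 \<or> c = 4")
      case True
      then have "(- s) ^ (c - 1) \<le> 0" using s by (auto simp: power3_eq_cube)
      then show ?thesis using s by (meson order_trans less_imp_le zero_le_power)
    next
      case 5: False
      have "(- s) ^ (c - 1) \<le> s ^ (c - 1)"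
        using power_abs[of "- s" "c - 1"] s by (metis abs_ge_self abs_minus abs_of_pos)
      also have "\<dots> \<le> s ^ 4" using 5 False c half s by (intro power_decreasing) auto
      finally show ?thesis .
    qed
    moreover have "\<beta> * (1 - s - \<beta>) \<le> \<beta> * (q_nat (- s) c - \<beta>)"
      using \<beta> q_nat_minus_ge[of s c] s half c by (intro mult_left_mono) auto
    moreover have "0 < s ^ 4" using s by simp
    moreover have "\<epsilon> \<le> \<beta> * (1 - s - \<beta>) - s ^ 4" by (simp add: \<epsilon>_def)
    ultimately show ?thesis by (simp only: max_def split: if_split) argo
  qed
  moreover have "0 < \<epsilon>" using gap gap3 by (simp add: \<epsilon>_def)
  moreover have "\<bar>- s\<bar> < 1" using s half by simp
  ultimately have "parabolic \<beta> \<epsilon> (of_real (- s))"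
    unfolding parabolic_of_real_iff using \<beta> by blast
  then show thesis by (rule that)
qed

lemma parabolic_real_interval:
  assumes "q \<in> {-R_star<..<1}"
  obtains \<beta> \<epsilon> where "parabolic \<beta> \<epsilon> (of_real q)"
proof (cases "0 \<le> q")
  case True
  then show thesis using assms by (intro that[OF parabolic_nonneg]) auto
next
  case False
  then have "0 < - q" "- q < R_star" using assms by auto
  then obtain \<epsilon> where "parabolic ((1 - (- q) + (- q)\<^sup>2) / 2) \<epsilon> (of_real (- (- q)))"
    by (rule parabolic_neg)
  then show thesis unfolding minus_minus by (rule that)
qed

section \<open>Positivity of the partial sums\<close>

text \<open>
  By the expansion at the first coefficient, the partial sum for \<open>c\<close> is $1 / ([c_0]_q - p V)$ with $V$
  the partial sum for the shifted sequence.  If $0 < V < 1/\beta$, then $p V \le \max(p, 0) / \beta < [c_0]_q - \beta$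
  by the half-plane condition, so the denominator exceeds $\beta$; it is at most
  $[c_0]_q + 1/\beta$ because $|p| \le 1$.  The lower bound does not involve $N$ and survives in the limit.
\<close>

lemma q_convergent_bounds:
  fixes q :: real
  assumes par: "parabolic \<beta> \<epsilon> (of_real q)" and c: "\<And>j. 2 \<le> c j"
  shows "1 / (q_nat q (c 0) + 1 / \<beta>) \<le> (\<Sum>n<Suc N. q_term c q n) \<and> (\<Sum>n<Suc N. q_term c q n) < 1 / \<beta>"
  using c
proof (induction N arbitrary: c)
  case (0 c)
  note pos = parabolicD(1-3)[OF par]
  have "\<epsilon> / \<beta> \<le> q_nat q (c 0) - \<beta>"
    using parabolicD(5)[OF par 0[of 0]] by (simp add: q_nat_of_real)
  moreover have "0 < \<epsilon> / \<beta>" using pos by simp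
  ultimately have "\<beta> < q_nat q (c 0)" by linarith
  then show ?case using pos by (simp add: q_term_def C_exp_def frac_le frac_less2)
next
  case (Suc N c)
  let ?d = "\<lambda>j. c (Suc j)"
  define V where "V = (\<Sum>n<Suc N. q_term ?d q n)"
  define p where "p = q ^ (c 0 - 1)"
  have pos: "0 < \<beta>" "0 < \<epsilon>" "\<bar>q\<bar> < 1"
    and c0: "max p 0 + \<epsilon> \<le> \<beta> * (q_nat q (c 0) - \<beta>)"
    using par Suc.prems[of 0] unfolding parabolic_of_real_iff p_def by auto
  have nz: "q_denom b q n \<noteq> 0" if "\<And>j. 2 \<le> b j" for b n
  proof -
    have "q_denom b (of_real q :: complex) n \<noteq> 0" using q_denom_invariant[where c = b, OF par that] by blast
    then show ?thesis by (simp add: q_denom_of_real)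
  qed
  have cf: "\<beta> < q_nat q (c j)" for j
  proof -
    have "\<epsilon> / \<beta> \<le> q_nat q (c j) - \<beta>"
      using parabolicD(5)[OF par Suc.prems] by (simp add: q_nat_of_real)
    moreover have "0 < \<epsilon> / \<beta>" using pos by simp
    ultimately show ?thesis by linarith
  qed
  have V: "1 / (q_nat q (c 1) + 1 / \<beta>) \<le> V" "V < 1 / \<beta>"
    using Suc.IH[of ?d] Suc.prems by (simp_all add: V_def)
  moreover have "0 < 1 / (q_nat q (c 1) + 1 / \<beta>)"
    using cf[of 1] pos by (simp add: add_pos_pos)
  ultimately have V0: "0 < V" by linarith
  have Veq: "V = q_denom (\<lambda>j. c (Suc (Suc j))) q N / q_denom ?d q (Suc N)"
    unfolding V_def by (rule sum_q_term) (use Suc.prems nz in auto)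
  have "(\<Sum>n<Suc (Suc N). q_term c q n) = q_denom ?d q (Suc N) / q_denom c q (Suc (Suc N))"
    by (rule sum_q_term) (use Suc.prems nz in auto)
  also have "\<dots> = 1 / (q_nat q (c 0) - p * V)"
    unfolding q_denom_first_step Veq p_def using nz[of ?d "Suc N"] Suc.prems
    by (simp add: divide_simps del: q_denom.simps)
  finally have eq: "(\<Sum>n<Suc (Suc N). q_term c q n) = 1 / (q_nat q (c 0) - p * V)" .
  have "p * V \<le> max p 0 * (1 / \<beta>)" using V V0 by (intro mult_mono) auto
  also have "\<dots> < q_nat q (c 0) - \<beta>" using c0 pos by (simp add: field_simps)
  finally have lower: "\<beta> < q_nat q (c 0) - p * V" by linarith
  have "\<bar>p\<bar> \<le> 1" using pos by (simp add: p_def power_abs power_le_one)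
  then have "\<bar>p\<bar> * V \<le> 1 * (1 / \<beta>)" using V V0 by (intro mult_mono) auto
  moreover have "- (\<bar>p\<bar> * V) \<le> p * V" using V0 by (simp add: abs_mult_pos abs_minus_le_zero flip: minus_mult_left)
  ultimately have upper: "q_nat q (c 0) - p * V \<le> q_nat q (c 0) + 1 / \<beta>" by simp
  show ?case unfolding eq using lower upper pos by (auto intro!: frac_le frac_less2)
qed

section \<open>Uniform convergence, holomorphy and real analyticity\<close>

definition parabolic_domain :: "complex set" where
  "parabolic_domain = {q. \<exists>\<beta> \<epsilon>. parabolic \<beta> \<epsilon> q}"

lemma parabolic_domainI: "parabolic \<beta> \<epsilon> q \<Longrightarrow> q \<in> parabolic_domain"
  unfolding parabolic_domain_def by blast

lemma open_parabolic_domain: "open parabolic_domain"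
  unfolding open_contains_ball
proof
  fix q
  assume "q \<in> parabolic_domain"
  then obtain \<beta> \<epsilon> where "parabolic \<beta> \<epsilon> q" by (auto simp: parabolic_domain_def)
  then obtain \<delta> where \<delta>: "0 < \<delta>" "\<forall>q'\<in>ball q \<delta>. parabolic \<beta> (\<epsilon> / 2) q'"
    using parabolic_near by blast
  then have "ball q \<delta> \<subseteq> parabolic_domain" by (intro subsetI parabolic_domainI) blast
  with \<delta>(1) show "\<exists>\<delta>>0. ball q \<delta> \<subseteq> parabolic_domain" by blast
qed

lemma real_interval_subset_parabolic_domain:
  "complex_of_real ` {-R_star<..<1} \<subseteq> parabolic_domain"
proof
  fix z
  assume "z \<in> complex_of_real ` {-R_star<..<1}"
  then obtain q where q: "z = of_real q" "q \<in> {-R_star<..<1}" by blast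
  show "z \<in> parabolic_domain"
    unfolding q(1) using q(2) by (rule parabolic_real_interval) (rule parabolic_domainI)
qed

lemma q_term_geometric_majorant:
  assumes c: "\<And>j. 2 \<le> c j" and q: "q \<in> parabolic_domain"
  obtains \<delta> b r where "0 < \<delta>" "ball q \<delta> \<subseteq> parabolic_domain" "summable (\<lambda>N. r ^ N * b)"
    "\<forall>q'\<in>ball q \<delta>. \<forall>N. norm (q_term c q' N) \<le> r ^ N * b"
proof -
  obtain \<beta> \<epsilon> where par: "parabolic \<beta> \<epsilon> q" using q by (auto simp: parabolic_domain_def)
  obtain \<delta> where \<delta>: "0 < \<delta>" "\<forall>q'\<in>ball q \<delta>. parabolic \<beta> (\<epsilon> / 2) q'"
    using parabolic_near[OF par] by blast
  have "ball q \<delta> \<subseteq> parabolic_domain"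
    using \<delta>(2) by (intro subsetI parabolic_domainI) (rule bspec)
  moreover have "summable (\<lambda>N. q_rate \<beta> (\<epsilon> / 2) ^ N * ((\<beta> + \<beta> / (\<epsilon> / 2)) / (\<epsilon> / 2)))"
    using parabolicD(1,2)[OF par] q_rate_bounds[of \<beta> "\<epsilon> / 2"]
    by (intro summable_mult2 summable_geometric) auto
  moreover have "\<forall>q'\<in>ball q \<delta>. \<forall>N. norm (q_term c q' N)
      \<le> q_rate \<beta> (\<epsilon> / 2) ^ N * ((\<beta> + \<beta> / (\<epsilon> / 2)) / (\<epsilon> / 2))"
    by (intro ballI allI norm_q_term_le c) (rule bspec[OF \<delta>(2)])
  ultimately show thesis by (rule that[OF \<delta>(1)])
qed

lemma q_denom_nonzero:
  assumes "\<And>j. 2 \<le> c j" "q \<in> parabolic_domain"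
  shows "q_denom c q N \<noteq> 0"
proof -
  obtain \<beta> \<epsilon> where par: "parabolic \<beta> \<epsilon> q" using assms(2) by (auto simp: parabolic_domain_def)
  show ?thesis by (rule conjunct1[OF q_denom_invariant[where c = c, OF par assms(1)]])
qed

lemma summable_norm_q_term:
  assumes "\<And>j. 2 \<le> c j" "q \<in> parabolic_domain"
  shows "summable (\<lambda>N. norm (q_term c q N))"
proof -
  obtain \<delta> b r where \<delta>: "0 < \<delta>" "ball q \<delta> \<subseteq> parabolic_domain" "summable (\<lambda>N. r ^ N * b)"
    and le: "\<forall>q'\<in>ball q \<delta>. \<forall>N. norm (q_term c q' N) \<le> r ^ N * b"
    by (rule q_term_geometric_majorant[where c = c, OF assms])
  have "norm (q_term c q N) \<le> r ^ N * b" for N using le \<delta>(1) by simp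
  then show ?thesis by (intro summable_comparison_test'[OF \<delta>(3), of 0]) simp
qed

lemma uniformly_convergent_norm_q_term:
  assumes c: "\<And>j. 2 \<le> c j" and K: "compact K" "K \<subseteq> parabolic_domain"
  shows "uniformly_convergent_on K (\<lambda>n q. \<Sum>N<n. norm (q_term c q N))"
proof -
  let ?f = "\<lambda>n q. \<Sum>N<n. norm (q_term c q N)" and ?g = "\<lambda>q. \<Sum>N. norm (q_term c q N)"
  have "\<exists>\<delta>>0. uniform_limit (ball q \<delta>) ?f ?g sequentially" if qK: "q \<in> K" for q
  proof -
    obtain \<delta> b r where \<delta>: "0 < \<delta>" "ball q \<delta> \<subseteq> parabolic_domain" "summable (\<lambda>N. r ^ N * b)"
      and le: "\<forall>q'\<in>ball q \<delta>. \<forall>N. norm (q_term c q' N) \<le> r ^ N * b"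
      by (rule q_term_geometric_majorant[where c = c, OF c subsetD[OF K(2) qK]])
    have "uniform_limit (ball q \<delta>) ?f ?g sequentially"
      by (rule Weierstrass_m_test[OF _ \<delta>(3)]) (use le in simp)
    with \<delta>(1) show ?thesis by blast
  qed
  then obtain \<delta> where \<delta>: "\<And>q. q \<in> K \<Longrightarrow> 0 < \<delta> q"
    "\<And>q. q \<in> K \<Longrightarrow> uniform_limit (ball q (\<delta> q)) ?f ?g sequentially" by metis
  have "K \<subseteq> (\<Union>q\<in>K. ball q (\<delta> q))" using \<delta>(1) by auto
  then obtain F where F: "F \<subseteq> K" "finite F" "K \<subseteq> (\<Union>q\<in>F. ball q (\<delta> q))"
    by (rule compactE_image[OF K(1) open_ball])
  have "uniform_limit (\<Union>q\<in>F. ball q (\<delta> q)) ?f ?g sequentially"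
    using F(1) \<delta>(2) by (intro uniform_limit_on_UNION[OF F(2)]) blast
  then have "uniform_limit K ?f ?g sequentially" by (rule uniform_limit_on_subset[OF _ F(3)])
  then show ?thesis by (auto simp: uniformly_convergent_on_def)
qed

lemma holomorphic_q_denom: "(\<lambda>q. q_denom c q N) holomorphic_on S"
proof (induction N rule: induct_nat_012)
  case 0
  show ?case by simp
next
  case 1
  show ?case unfolding q_denom.simps q_nat_def by (intro holomorphic_intros)
next
  case (ge2 N)
  show ?case unfolding q_denom.simps q_nat_def by (intro holomorphic_intros ge2.IH)
qed

lemma holomorphic_q_series:
  assumes c: "\<And>j. 2 \<le> c j"
  shows "(\<lambda>q. \<Sum>N. q_term c q N) holomorphic_on parabolic_domain"
proof (rule holomorphic_uniform_sequence[OF open_parabolic_domain])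
  show "(\<lambda>q. \<Sum>N<n. q_term c q N) holomorphic_on parabolic_domain" for n
    unfolding q_term_def
    using q_denom_nonzero[where c = c, OF c]
    by (intro holomorphic_on_sum holomorphic_on_divide holomorphic_on_mult
        holomorphic_on_power holomorphic_on_ident holomorphic_q_denom) auto
  fix q
  assume "q \<in> parabolic_domain"
  then obtain \<delta> b r where \<delta>: "0 < \<delta>" "ball q \<delta> \<subseteq> parabolic_domain" "summable (\<lambda>N. r ^ N * b)"
    and le: "\<forall>q'\<in>ball q \<delta>. \<forall>N. norm (q_term c q' N) \<le> r ^ N * b"
    by (rule q_term_geometric_majorant[where c = c, OF c])
  have sub: "cball q (\<delta> / 2) \<subseteq> ball q \<delta>" using \<delta>(1) by auto
  have "uniform_limit (cball q (\<delta> / 2)) (\<lambda>n q. \<Sum>N<n. q_term c q N)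
      (\<lambda>q. \<Sum>N. q_term c q N) sequentially"
    by (rule Weierstrass_m_test[OF _ \<delta>(3)]) (use le sub in blast)
  moreover have "cball q (\<delta> / 2) \<subseteq> parabolic_domain" "0 < \<delta> / 2" using \<delta>(1,2) sub by auto
  ultimately show "\<exists>d>0. cball q d \<subseteq> parabolic_domain \<and>
      uniform_limit (cball q d) (\<lambda>n q. \<Sum>N<n. q_term c q N) (\<lambda>q. \<Sum>N. q_term c q N) sequentially"
    by blast
qed

lemma summable_q_term_real:
  fixes q :: real
  assumes "\<And>j. 2 \<le> c j" "q \<in> {-R_star<..<1}"
  shows "summable (q_term c q)"
proof -
  have "of_real q \<in> parabolic_domain" using assms(2) real_interval_subset_parabolic_domain by blast
  then have "summable (\<lambda>N. norm (q_term c (of_real q :: complex) N))"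
    by (rule summable_norm_q_term[OF assms(1)])
  then show ?thesis by (intro summable_norm_cancel[of "q_term c q"]) (simp add: q_term_of_real)
qed

lemma suminf_q_term_pos:
  fixes q :: real
  assumes c: "\<And>j. 2 \<le> c j" and q: "q \<in> {-R_star<..<1}"
  shows "0 < (\<Sum>N. q_term c q N)"
proof -
  obtain \<beta> \<epsilon> where par: "parabolic \<beta> \<epsilon> (of_real q)" by (rule parabolic_real_interval[OF q])
  note pos = parabolicD(1,2)[OF par]
  have "(\<lambda>n. \<Sum>N<n. q_term c q N) \<longlonglongrightarrow> (\<Sum>N. q_term c q N)"
    using summable_q_term_real[OF c q] by (rule summable_LIMSEQ)
  then have "(\<lambda>n. \<Sum>N<Suc n. q_term c q N) \<longlonglongrightarrow> (\<Sum>N. q_term c q N)" by (rule LIMSEQ_Suc)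
  moreover have "1 / (q_nat q (c 0) + 1 / \<beta>) \<le> (\<Sum>N<Suc n. q_term c q N)" for n
    using q_convergent_bounds[where c = c, OF par c] by blast
  ultimately have "1 / (q_nat q (c 0) + 1 / \<beta>) \<le> (\<Sum>N. q_term c q N)"
    by (intro LIMSEQ_le_const) auto
  moreover have "0 < q_nat q (c 0)"
  proof -
    have "\<epsilon> / \<beta> \<le> q_nat q (c 0) - \<beta>"
      using parabolicD(5)[OF par c[of 0]] by (simp add: q_nat_of_real)
    moreover have "0 < \<epsilon> / \<beta>" using pos by simp
    ultimately show ?thesis using pos by linarith
  qed
  then have "0 < 1 / (q_nat q (c 0) + 1 / \<beta>)" using pos by (simp add: add_pos_pos)
  ultimately show ?thesis by linarith
qed

text \<open>
  At a real centre the Taylor coefficients may be replaced by their real parts, since the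
  values and the increments are real.
\<close>

lemma real_analytic_onI:
  assumes S: "open S" and U: "open U" "complex_of_real ` S \<subseteq> U"
    and F: "F holomorphic_on U" and f: "\<And>s. s \<in> S \<Longrightarrow> F (of_real s) = of_real (f s)"
  shows "real_analytic_on f S"
  unfolding real_analytic_on_def
proof
  fix t
  assume t: "t \<in> S"
  obtain r1 where r1: "0 < r1" "ball t r1 \<subseteq> S" using S t open_contains_ball by metis
  obtain r2 where r2: "0 < r2" "ball (complex_of_real t) r2 \<subseteq> U"
    using U t open_contains_ball by (metis imageI subsetD)
  define b where "b n = Re ((deriv ^^ n) F (of_real t) / fact n)" for n
  have "(\<lambda>n. b n * (s - t) ^ n) sums f s" if s: "\<bar>s - t\<bar> < min r1 r2" for s
  proof -
    have "s \<in> S" using s r1 by (auto simp: dist_real_def abs_minus_commute)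
    have "dist (complex_of_real t) (of_real s) = \<bar>s - t\<bar>"
      unfolding dist_of_real by (simp add: dist_real_def abs_minus_commute)
    then have "(\<lambda>n. (deriv ^^ n) F (of_real t) / fact n * (of_real s - of_real t) ^ n) sums F (of_real s)"
      using s by (intro holomorphic_power_series[of F _ r2] holomorphic_on_subset[OF F r2(2)]) simp
    then have "(\<lambda>n. Re ((deriv ^^ n) F (of_real t) / fact n * (of_real s - of_real t) ^ n)) sums Re (F (of_real s))"
      by (rule sums_Re)
    moreover have "Re (z * (of_real s - of_real t) ^ n) = Re z * (s - t) ^ n" for z n
      unfolding of_real_diff[symmetric] of_real_power[symmetric] by simp
    ultimately have "(\<lambda>n. b n * (s - t) ^ n) sums Re (F (of_real s))" by (simp only: b_def)
    then show ?thesis using f[OF \<open>s \<in> S\<close>] by simp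
  qed
  then show "\<exists>r>0. \<exists>b. \<forall>s. \<bar>s - t\<bar> < r \<longrightarrow> (\<lambda>n. b n * (s - t) ^ n) sums f s"
    using r1(1) r2(1) by (intro exI[of _ "min r1 r2"] conjI exI[of _ b]) auto
qed

lemma real_analytic_q_real_at:
  assumes c: "\<And>j. 2 \<le> nc_coeffs x j"
  shows "real_analytic_on (q_real_at x) {-R_star<..<1}"
proof -
  define F where "F q = (\<Sum>N. q_term (nc_coeffs x) q N)" for q :: complex
  have hol: "F holomorphic_on parabolic_domain"
    unfolding F_def by (rule holomorphic_q_series) (rule c)
  have real: "F (of_real s) = of_real (\<Sum>N. q_term (nc_coeffs x) s N)" if "s \<in> {-R_star<..<1}" for s
    unfolding F_def q_term_of_real
    using summable_q_term_real[OF c that] by (rule suminf_of_real[symmetric])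
  \<comment> \<open>Positivity excludes zeros of the sum only on the real interval, hence the smaller open set.\<close>
  define U where "U = {q \<in> parabolic_domain. F q \<noteq> 0}"
  have "open (F -` (- {0}) \<inter> parabolic_domain)"
    using holomorphic_on_imp_continuous_on[OF hol] open_parabolic_domain
    by (simp add: continuous_on_open_vimage open_Compl)
  moreover have "F -` (- {0}) \<inter> parabolic_domain = U" by (auto simp: U_def)
  ultimately have U: "open U" by simp
  have sub: "complex_of_real ` {-R_star<..<1} \<subseteq> U"
  proof
    fix z
    assume "z \<in> complex_of_real ` {-R_star<..<1}"
    then obtain s where s: "z = of_real s" "s \<in> {-R_star<..<1}" by blast
    have "0 < (\<Sum>N. q_term (nc_coeffs x) s N)" by (rule suminf_q_term_pos[OF c s(2)])
    then show "z \<in> U"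
      using s real_interval_subset_parabolic_domain by (auto simp: U_def real)
  qed
  have "(\<lambda>q. 1 / F q) holomorphic_on U"
    by (intro holomorphic_intros holomorphic_on_subset[OF hol]) (auto simp: U_def)
  then show ?thesis
    by (rule real_analytic_onI[OF open_greaterThanLessThan U sub]) (simp add: real q_real_at_def)
qed

theorem theorem4p20:
  shows "\<exists>U::complex set. open U \<and> complex_of_real ` {-R_star<..<1} \<subseteq> U \<and>
    (\<forall>x::real. x > 1 \<longrightarrow>
      (\<lambda>N. fps_X ^ C_exp (nc_coeffs x) N *
           fps_recip (q_denom (nc_coeffs x) fps_X N * q_denom (nc_coeffs x) fps_X (Suc N)))
        sums fps_recip (q_real x) \<and>
      (\<forall>q\<in>U. \<forall>N. q_denom (nc_coeffs x) q N \<noteq> 0) \<and>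
      (\<forall>q\<in>U. summable (\<lambda>N. norm (q_term (nc_coeffs x) q N))) \<and>
      (\<forall>K. compact K \<and> K \<subseteq> U \<longrightarrow>
        uniformly_convergent_on K (\<lambda>n q. \<Sum>N<n. norm (q_term (nc_coeffs x) q N))) \<and>
      (\<lambda>q. \<Sum>N. q_term (nc_coeffs x) q N) holomorphic_on U \<and>
      (\<forall>q\<in>{-R_star<..<1}. 0 < (\<Sum>N. q_term (nc_coeffs x) q N)) \<and>
      real_analytic_on (q_real_at x) {-R_star<..<1})"
proof (intro exI[of _ parabolic_domain] conjI allI impI)
  show "open parabolic_domain" by (rule open_parabolic_domain)
  show "complex_of_real ` {-R_star<..<1} \<subseteq> parabolic_domain"
    by (rule real_interval_subset_parabolic_domain)
next
  fix x :: real
  assume x: "1 < x"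
  then have c: "2 \<le> nc_coeffs x j" for j
    using nc_expansion_nc_coeffs[of x] by (simp add: nc_expansion_def)
  show "(\<lambda>N. fps_X ^ C_exp (nc_coeffs x) N *
           fps_recip (q_denom (nc_coeffs x) fps_X N * q_denom (nc_coeffs x) fps_X (Suc N)))
        sums fps_recip (q_real x)"
    using x by (intro fps_q_term_sums) simp
  show "\<forall>q\<in>parabolic_domain. \<forall>N. q_denom (nc_coeffs x) q N \<noteq> 0"
    by (intro ballI allI q_denom_nonzero c)
  show "\<forall>q\<in>parabolic_domain. summable (\<lambda>N. norm (q_term (nc_coeffs x) q N))"
    by (intro ballI summable_norm_q_term c)
  show "uniformly_convergent_on K (\<lambda>n q. \<Sum>N<n. norm (q_term (nc_coeffs x) q N))"
    if "compact K \<and> K \<subseteq> parabolic_domain" for K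
    using that c by (intro uniformly_convergent_norm_q_term) auto
  show "(\<lambda>q. \<Sum>N. q_term (nc_coeffs x) q N) holomorphic_on parabolic_domain"
    by (rule holomorphic_q_series) (rule c)
  show "\<forall>q\<in>{-R_star<..<1}. 0 < (\<Sum>N. q_term (nc_coeffs x) q N)"
    by (intro ballI suminf_q_term_pos c)
  show "real_analytic_on (q_real_at x) {-R_star<..<1}"
    by (rule real_analytic_q_real_at) (rule c)
qed

end
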